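(* Let $J\ge1$, $(\bm\omega,s)\in\mathcal U$, $0<a_0\le1$ and $0<a_j<1$ for $1\le j\le J$. Let $\hat{\bm\rho}_j\in\mathbb C^6$, $0\le j\le J+1$, satisfy $$s\Lambda\hat{\bm\rho}_1-\widehat{\mathcal L}_0\hat{\bm\rho}_0=\bm0,\qquad\widehat{\mathcal L}_j\hat{\bm\rho}_j-\widehat{\mathcal K}_j\hat{\bm\rho}_{j+1}=\bm0\ (1\le j\le J),\qquad\hat{\bm\rho}_{J+1,-}=\bm0,$$ $$\hat{\bm\rho}_{1,\mathrm s}=\tfrac1s(\mathrm i\omega_2E_T-\mathrm i\omega_3J_T)\hat{\bm\rho}_{1,+}+\tfrac1s(\mathrm i\omega_2D_T-\mathrm i\omega_3I_T)\hat{\bm\rho}_{1,-},$$ and let $\bm c_0,\bm d_0\in\mathbb C^2$ be the coefficients in the representation $\hat{\bm\rho}_0=\Psi_L\bm c_0+\Psi_R\bm d_0$. Then $\bm c_0=\mathrm R\,\bm d_0$ with $\mathrm R\in\mathbb C^{2\times2}$ given by $$\mathrm R=-\frac{\gamma_J}{(\kappa+s)^2}\hat M_{\bm\omega},\qquad \gamma_J=\frac{\gamma_0^-}{\gamma_0^+}\prod_{j=1}^J\Big(\frac{\gamma_j^-}{\gamma_j^+}\Big)^2,\qquad\gamma_j^\pm=a_js\pm\kappa.$$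
   Context: $\mathcal U=\{(\bm\omega,s)\in\mathbb R^2\times\mathbb C:\operatorname{Re}s>0\}$, $\bm\omega=(\omega_2,\omega_3)$, $\kappa=\sqrt{s^2+|\bm\omega|^2}$ (principal branch). Vectors in $\mathbb C^6$ are written $\hat{\bm\rho}=(\hat{\bm\rho}_+^\top,\hat{\bm\rho}_{\mathrm s}^\top,\hat{\bm\rho}_-^\top)^\top$ with three components in $\mathbb C^2$. $\Lambda=\operatorname{diag}(1,1,0,0,-1,-1)$ and $$\widehat{\mathcal L}_j=(a_j\Lambda-I_6)s-\mathrm i\omega_2\widetilde A_2-\mathrm i\omega_3\widetilde A_3,\qquad\widehat{\mathcal K}_j=(a_j\Lambda+I_6)s+\mathrm i\omega_2\widetilde A_2+\mathrm i\omega_3\widetilde A_3,$$ $$\widetilde A_2=\begin{pmatrix}0&-E_T&0\\-E_T&0&-D_T\\0&D_T&0\end{pmatrix},\qquad\widetilde A_3=\begin{pmatrix}0&J_T&0\\ J_T&0&I_T\\0&I_T&0\end{pmatrix},$$ with $E_T=\tfrac{\sqrt2}2\begin{pmatrix}0&1\\1&0\end{pmatrix}$, $D_T=\tfrac{\sqrt2}2\begin{pmatrix}0&1\\-1&0\end{pmatrix}$, $I_T=\tfrac{\sqrt2}2I_2$, $J_T=\tfrac{\sqrt2}2\begin{pmatrix}1&0\\0&-1\end{pmatrix}$. The matrices $\Psi_L,\Psi_R\in\mathbb C^{6\times2}$ are $$\Psi_L=\frac1{c_\Psi}\begin{pmatrix}\hat M_{\bm\omega}\\ \mathrm i\sqrt2(\kappa+s)\hat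 O_L\\(\kappa+s)^2I_2\end{pmatrix},\qquad\Psi_R=\frac1{c_\Psi}\begin{pmatrix}(\kappa+s)^2I_2\\ \mathrm i\sqrt2(\kappa+s)\hat O_R\\ \hat M_{\bm\omega}\end{pmatrix},\qquad c_\Psi=\sqrt{|\kappa+s|^4+|\bm\omega|^4},$$ $\hat O_L=\begin{pmatrix}-\omega_3&\omega_2\\-\omega_2&-\omega_3\end{pmatrix}$, $\hat O_R=\begin{pmatrix}-\omega_3&\omega_2\\ \omega_2&\omega_3\end{pmatrix}$, $\hat M_{\bm\omega}=\begin{pmatrix}\omega_2^2-\omega_3^2&2\omega_2\omega_3\\2\omega_2\omega_3&-(\omega_2^2-\omega_3^2)\end{pmatrix}$. Under the stated hypotheses each $\hat{\bm\rho}_j$ (in particular $\hat{\bm\rho}_0$) lies in the span of the columns of $\Psi_L$ and $\Psi_R$, so $\bm c_0,\bm d_0$ are well defined. *)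

theory Defs
  imports "HOL-Analysis.Analysis"
begin

text \<open>
  The frequency vector \<open>\<omega> = (\<omega>\<^sub>2, \<omega>\<^sub>3)\<close> is a \<^typ>\<open>real^2\<close>, so the vector index is
  shifted: \<open>\<omega>\<^sub>2 = \<omega> $ 1\<close> and \<open>\<omega>\<^sub>3 = \<omega> $ 2\<close>.
\<close>

definition U_set :: "((real^2) \<times> complex) set" where
  "U_set = {(\<omega>, s). Re s > 0}"

definition kap :: "real^2 \<Rightarrow> complex \<Rightarrow> complex" where
  "kap \<omega> s = csqrt (s^2 + complex_of_real ((norm \<omega>)^2))"

text \<open>The library only scales matrices by reals (\<open>*\<^sub>R\<close>) and vectors by ring elements (\<open>*s\<close>).\<close>

definition scale_mat :: "complex \<Rightarrow> complex^'n^'m \<Rightarrow> complex^'n^'m" (infixr "*m" 70) where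
  "c *m A = map_matrix (\<lambda>x. c * x) A"

text \<open>
  Stacking of three blocks of height two. With \<open>'b = complex\<close> it builds a vector of \<open>\<complex>\<^sup>6\<close>
  from its components \<open>(+, s, -)\<close>; with \<open>'b = complex^'n\<close> (a row) it stacks three
  \<open>2 \<times> n\<close> matrices vertically.
\<close>

definition stack3 :: "'b::zero^2 \<Rightarrow> 'b^2 \<Rightarrow> 'b^2 \<Rightarrow> 'b^6" where
  "stack3 p q r = vector [p$1, p$2, q$1, q$2, r$1, r$2]"

definition block_row3 :: "complex^2^2 \<Rightarrow> complex^2^2 \<Rightarrow> complex^2^2 \<Rightarrow> complex^6^2" where
  "block_row3 P Q R = (\<chi> i. stack3 (P$i) (Q$i) (R$i))"

lemma stack3_nth [simp]:
  "stack3 p q r $ 1 = p$1" "stack3 p q r $ 2 = p$2" "stack3 p q r $ 3 = q$1"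
  "stack3 p q r $ 4 = q$2" "stack3 p q r $ 5 = r$1" "stack3 p q r $ 6 = r$2"
  by (simp_all add: stack3_def vector_def)

definition plus_part :: "complex^6 \<Rightarrow> complex^2" where
  "plus_part x = vector [x$1, x$2]"

definition s_part :: "complex^6 \<Rightarrow> complex^2" where
  "s_part x = vector [x$3, x$4]"

definition minus_part :: "complex^6 \<Rightarrow> complex^2" where
  "minus_part x = vector [x$5, x$6]"

definition mat2 :: "complex \<Rightarrow> complex \<Rightarrow> complex \<Rightarrow> complex \<Rightarrow> complex^2^2" where
  "mat2 a b c d = vector [vector [a, b], vector [c, d]]"

definition E_T :: "complex^2^2" where
  "E_T = complex_of_real (sqrt 2 / 2) *m mat2 0 1 1 0"

definition D_T :: "complex^2^2" where
  "D_T = complex_of_real (sqrt 2 / 2) *m mat2 0 1 (-1) 0"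

definition I_T :: "complex^2^2" where
  "I_T = complex_of_real (sqrt 2 / 2) *m mat 1"

definition J_T :: "complex^2^2" where
  "J_T = complex_of_real (sqrt 2 / 2) *m mat2 1 0 0 (-1)"

definition A2 :: "complex^6^6" where
  "A2 = stack3
     (block_row3 0 (- E_T) 0)
     (block_row3 (- E_T) 0 (- D_T))
     (block_row3 0 D_T 0)"

definition A3 :: "complex^6^6" where
  "A3 = stack3
     (block_row3 0 J_T 0)
     (block_row3 J_T 0 I_T)
     (block_row3 0 I_T 0)"

definition Lam :: "complex^6^6" where
  "Lam = (\<chi> i j. if i = j then vector [1, 1, 0, 0, -1, -1] $ i else 0)"

definition L_mat :: "real \<Rightarrow> real^2 \<Rightarrow> complex \<Rightarrow> complex^6^6" where
  "L_mat a \<omega> s =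
     s *m (complex_of_real a *m Lam - mat 1)
     - (\<i> * complex_of_real (\<omega>$1)) *m A2 - (\<i> * complex_of_real (\<omega>$2)) *m A3"

definition K_mat :: "real \<Rightarrow> real^2 \<Rightarrow> complex \<Rightarrow> complex^6^6" where
  "K_mat a \<omega> s =
     s *m (complex_of_real a *m Lam + mat 1)
     + (\<i> * complex_of_real (\<omega>$1)) *m A2 + (\<i> * complex_of_real (\<omega>$2)) *m A3"

definition O_L :: "real^2 \<Rightarrow> complex^2^2" where
  "O_L \<omega> = (let w2 = complex_of_real (\<omega>$1); w3 = complex_of_real (\<omega>$2)
     in mat2 (- w3) w2 (- w2) (- w3))"

definition O_R :: "real^2 \<Rightarrow> complex^2^2" where
  "O_R \<omega> = (let w2 = complex_of_real (\<omega>$1); w3 = complex_of_real (\<omega>$2)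
     in mat2 (- w3) w2 w2 w3)"

definition M_mat :: "real^2 \<Rightarrow> complex^2^2" where
  "M_mat \<omega> = (let w2 = complex_of_real (\<omega>$1); w3 = complex_of_real (\<omega>$2)
     in mat2 (w2^2 - w3^2) (2 * w2 * w3) (2 * w2 * w3) (- (w2^2 - w3^2)))"

definition c_Psi :: "real^2 \<Rightarrow> complex \<Rightarrow> real" where
  "c_Psi \<omega> s = sqrt ((cmod (kap \<omega> s + s))^4 + (norm \<omega>)^4)"

definition Psi_L :: "real^2 \<Rightarrow> complex \<Rightarrow> complex^2^6" where
  "Psi_L \<omega> s = (1 / complex_of_real (c_Psi \<omega> s)) *m stack3
     (M_mat \<omega>)
     ((\<i> * complex_of_real (sqrt 2) * (kap \<omega> s + s)) *m O_L \<omega>)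
     ((kap \<omega> s + s)^2 *m mat 1)"

definition Psi_R :: "real^2 \<Rightarrow> complex \<Rightarrow> complex^2^6" where
  "Psi_R \<omega> s = (1 / complex_of_real (c_Psi \<omega> s)) *m stack3
     ((kap \<omega> s + s)^2 *m mat 1)
     ((\<i> * complex_of_real (sqrt 2) * (kap \<omega> s + s)) *m O_R \<omega>)
     (M_mat \<omega>)"

definition gam_plus :: "real \<Rightarrow> real^2 \<Rightarrow> complex \<Rightarrow> complex" where
  "gam_plus a \<omega> s = complex_of_real a * s + kap \<omega> s"

definition gam_minus :: "real \<Rightarrow> real^2 \<Rightarrow> complex \<Rightarrow> complex" where
  "gam_minus a \<omega> s = complex_of_real a * s - kap \<omega> s"

text \<open>
  The overall factor \<open>\<gamma>\<^sub>J\<close> without superscript; the sequence \<open>a\<close> supplies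
  \<open>\<gamma>\<^sub>j\<^sup>\<plusminus> = a\<^sub>j s \<plusminus> \<kappa>\<close>.
\<close>

definition gam :: "nat \<Rightarrow> (nat \<Rightarrow> real) \<Rightarrow> real^2 \<Rightarrow> complex \<Rightarrow> complex" where
  "gam J a \<omega> s = gam_minus (a 0) \<omega> s / gam_plus (a 0) \<omega> s
     * (\<Prod>j=1..J. (gam_minus (a j) \<omega> s / gam_plus (a j) \<omega> s)^2)"

definition R_mat :: "nat \<Rightarrow> (nat \<Rightarrow> real) \<Rightarrow> real^2 \<Rightarrow> complex \<Rightarrow> complex^2^2" where
  "R_mat J a \<omega> s = (- (gam J a \<omega> s / (kap \<omega> s + s)^2)) *m M_mat \<omega>"

end

theory Submission
  imports Defs
begin

text \<open>
  Put \<open>N = s + \<i> \<omega>\<^sub>2 A\<^sub>2 + \<i> \<omega>\<^sub>3 A\<^sub>3\<close>, so that \<open>\<L>\<^sub>j = a\<^sub>j s \<Lambda> - N\<close> and \<open>\<K>\<^sub>j = a\<^sub>j s \<Lambda> + N\<close>.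
  The middle block of \<open>\<Lambda>\<close> vanishes, so the middle rows of all the equations together with the
  condition on the middle component of \<open>\<rho>\<^sub>1\<close> say exactly that the middle component of \<open>N \<rho>\<^sub>j\<close> is
  zero for every \<open>j\<close>. On the space of such vectors \<open>\<Lambda> N\<close> is, in the variables \<open>(\<rho>\<^sub>+, \<rho>\<^sub>-)\<close>, a
  \<open>4 \<times> 4\<close> matrix (a Schur complement, \<open>N_mat_schur_complement\<close>) with eigenvalues \<open>\<plusminus>\<kappa>\<close>.

  Rather than expanding each \<open>\<rho>\<^sub>j\<close> in the right eigenvectors \<open>\<Psi>\<^sub>L\<close>, \<open>\<Psi>\<^sub>R\<close>, the proof evaluates left
  eigenvectors on it, which can be done before any expansion is known to exist: with \<open>\<sigma> = \<kappa> + s\<close>, the functionals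
  \<open>\<Phi>(x) = \<sigma>\<^sup>2 x\<^sub>- - M x\<^sub>+\<close> and \<open>\<Theta>(x) = \<sigma>\<^sup>2 x\<^sub>+ - M x\<^sub>-\<close> satisfy, on that space, \<open>\<Phi>(\<Lambda> N x) = - \<kappa> \<Phi>(x)\<close> and
  \<open>\<Theta>(\<Lambda> N x) = \<kappa> \<Theta>(x)\<close> (\<open>coef_Lam_N_mat\<close>; the algebra behind it is \<open>M\<^sup>2 = |\<omega>|\<^sup>4\<close> and
  \<open>\<kappa>\<^sup>2 = s\<^sup>2 + |\<omega>|\<^sup>2\<close>). Since \<open>\<Lambda>\<^sup>2\<close> is the identity on the outer blocks, applying \<open>\<Phi> \<circ> \<Lambda>\<close> and
  \<open>\<Theta> \<circ> \<Lambda>\<close> to the equations decouples them into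
  \<open>\<gamma>\<^sub>j\<^sup>+ \<Phi>(\<rho>\<^sub>j) = \<gamma>\<^sub>j\<^sup>- \<Phi>(\<rho>\<^sub>j\<^sub>+\<^sub>1)\<close> and \<open>\<gamma>\<^sub>j\<^sup>- \<Theta>(\<rho>\<^sub>j) = \<gamma>\<^sub>j\<^sup>+ \<Theta>(\<rho>\<^sub>j\<^sub>+\<^sub>1)\<close>,
  preceded by \<open>s \<Phi>(\<rho>\<^sub>1) = \<gamma>\<^sub>0\<^sup>+ \<Phi>(\<rho>\<^sub>0)\<close> and \<open>s \<Theta>(\<rho>\<^sub>1) = \<gamma>\<^sub>0\<^sup>- \<Theta>(\<rho>\<^sub>0)\<close>.
  The end condition \<open>\<rho>\<^sub>J\<^sub>+\<^sub>1\<^sub>,\<^sub>- = 0\<close> gives \<open>\<sigma>\<^sup>2 \<Phi>(\<rho>\<^sub>J\<^sub>+\<^sub>1) = - M \<Theta>(\<rho>\<^sub>J\<^sub>+\<^sub>1)\<close>. The wave \<open>\<Theta>\<close> thus travels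
  out to \<open>J + 1\<close>, is reflected, and returns as \<open>\<Phi>\<close>, picking up each factor \<open>\<gamma>\<^sub>j\<^sup>- / \<gamma>\<^sub>j\<^sup>+\<close> with
  \<open>j \<ge> 1\<close> twice; for \<open>j = 0\<close> the way out contributes \<open>\<gamma>\<^sub>0\<^sup>- / s\<close> and the way back \<open>s / \<gamma>\<^sub>0\<^sup>+\<close>.

  Finally \<open>\<Phi>\<close> and \<open>\<Theta>\<close> send \<open>\<Psi>\<^sub>L c + \<Psi>\<^sub>R d\<close> to the same multiple of \<open>c\<close> and of \<open>d\<close>
  (\<open>coef_Psi\<close>), and this multiple is nonzero because \<open>Re \<kappa> > 0\<close> (\<open>Psi_determinant\<close>,
  \<open>Re_kap_pos\<close>).
\<close>

section \<open>Vectors with six components\<close>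

lemma exhaust_6:
  fixes x :: 6
  shows "x = 1 \<or> x = 2 \<or> x = 3 \<or> x = 4 \<or> x = 5 \<or> x = 6"
proof (induct x)
  case (of_int z)
  then have "0 \<le> z" and "z < 6" by simp_all
  then have "z = 0 \<or> z = 1 \<or> z = 2 \<or> z = 3 \<or> z = 4 \<or> z = 5" by arith
  then show ?case by auto
qed

lemma UNIV_6: "UNIV = {1::6, 2, 3, 4, 5, 6}"
  using exhaust_6 by auto

lemma sum_6: "sum f (UNIV::6 set) = f 1 + f 2 + f 3 + f 4 + f 5 + f 6"
  unfolding UNIV_6 by (simp add: ac_simps)

lemma part_nth [simp]:
  "plus_part x $ 1 = x $ 1" "plus_part x $ 2 = x $ 2"
  "s_part x $ 1 = x $ 3" "s_part x $ 2 = x $ 4"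
  "minus_part x $ 1 = x $ 5" "minus_part x $ 2 = x $ 6"
  by (simp_all add: plus_part_def s_part_def minus_part_def)

lemma mat2_mult_nth [simp]:
  "(mat2 a b c d *v v) $ 1 = a * v $ 1 + b * v $ 2"
  "(mat2 a b c d *v v) $ 2 = c * v $ 1 + d * v $ 2"
  by (simp_all add: mat2_def matrix_vector_mult_def sum_2)

lemma scale_mat_nth [simp]: "(c *m A) $ i $ j = c * A $ i $ j"
  by (simp add: scale_mat_def map_matrix_def)

lemma scale_mat_mult_nth [simp]: "((c *m A) *v x) $ i = c * (A *v x) $ i"
  by (simp add: matrix_vector_mult_def sum_distrib_left mult.assoc)

lemma Lam_mult_nth [simp]:
  "(Lam *v x) $ 1 = x $ 1" "(Lam *v x) $ 2 = x $ 2"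
  "(Lam *v x) $ 3 = 0" "(Lam *v x) $ 4 = 0"
  "(Lam *v x) $ 5 = - x $ 5" "(Lam *v x) $ 6 = - x $ 6"
  by (simp_all add: matrix_vector_mult_def sum_6 Lam_def vector_def)

section \<open>The common part of the layer operators\<close>

definition N_mat :: "real^2 \<Rightarrow> complex \<Rightarrow> complex^6^6" where
  "N_mat \<omega> s = s *m mat 1 + (\<i> * complex_of_real (\<omega>$1)) *m A2 + (\<i> * complex_of_real (\<omega>$2)) *m A3"

lemma L_mat_mult_nth: "(L_mat a \<omega> s *v x) $ i = complex_of_real a * s * (Lam *v x) $ i - (N_mat \<omega> s *v x) $ i"
proof -
  have "L_mat a \<omega> s = (complex_of_real a * s) *m Lam - N_mat \<omega> s"
    by (simp add: vec_eq_iff L_mat_def N_mat_def algebra_simps)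
  then show ?thesis by (simp add: matrix_vector_mult_diff_rdistrib)
qed

lemma K_mat_mult_nth: "(K_mat a \<omega> s *v x) $ i = complex_of_real a * s * (Lam *v x) $ i + (N_mat \<omega> s *v x) $ i"
proof -
  have "K_mat a \<omega> s = (complex_of_real a * s) *m Lam + N_mat \<omega> s"
    by (simp add: vec_eq_iff K_mat_def N_mat_def algebra_simps)
  then show ?thesis by (simp add: matrix_vector_mult_add_rdistrib)
qed

lemma N_mat_mult_nth:
  fixes \<omega> :: "real^2" and s :: complex and x :: "complex^6"
  defines "w2 \<equiv> complex_of_real (\<omega>$1)" and "w3 \<equiv> complex_of_real (\<omega>$2)"
    and "t \<equiv> \<i> * complex_of_real (sqrt 2 / 2)"
  shows
    "(N_mat \<omega> s *v x) $ 1 = s * x$1 + t * (w3 * x$3 - w2 * x$4)"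
    "(N_mat \<omega> s *v x) $ 2 = s * x$2 - t * (w2 * x$3 + w3 * x$4)"
    "(N_mat \<omega> s *v x) $ 3 = s * x$3 - t * (w2 * x$2 - w3 * x$1 + w2 * x$6 - w3 * x$5)"
    "(N_mat \<omega> s *v x) $ 4 = s * x$4 - t * (w2 * x$1 + w3 * x$2 - w2 * x$5 - w3 * x$6)"
    "(N_mat \<omega> s *v x) $ 5 = s * x$5 + t * (w3 * x$3 + w2 * x$4)"
    "(N_mat \<omega> s *v x) $ 6 = s * x$6 + t * (w3 * x$4 - w2 * x$3)"
  by (simp_all add: N_mat_def w2_def w3_def t_def matrix_vector_mult_add_rdistrib mat_def)
     (simp_all add: matrix_vector_mult_def sum_6 A2_def A3_def block_row3_def
       E_T_def D_T_def J_T_def I_T_def mat2_def mat_def field_simps)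

text \<open>
  The hypothesis on the middle component of \<open>\<rho>\<^sub>1\<close> in the form in which it propagates through the
  recursion.
\<close>

lemma s_part_N_mat_zero_iff:
  assumes "s \<noteq> 0"
  shows "s_part (N_mat \<omega> s *v x) = 0 \<longleftrightarrow> s_part x =
       (1 / s) *s (((\<i> * complex_of_real (\<omega>$1)) *m E_T
                    - (\<i> * complex_of_real (\<omega>$2)) *m J_T) *v plus_part x)
     + (1 / s) *s (((\<i> * complex_of_real (\<omega>$1)) *m D_T
                    - (\<i> * complex_of_real (\<omega>$2)) *m I_T) *v minus_part x)"
    (is "_ \<longleftrightarrow> _ = ?r")
proof -
  have "s_part (N_mat \<omega> s *v x) = s *s (s_part x - ?r)"
    using assms
    by (simp add: vec_eq_iff forall_2 N_mat_mult_nth matrix_vector_mult_diff_rdistrib E_T_def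
        D_T_def J_T_def I_T_def) (simp add: field_simps)
  then show ?thesis
    using assms by (simp only: vector_mul_eq_0 right_minus_eq) simp
qed

lemma M_mat_mult_nth [simp]:
  fixes \<omega> :: "real^2"
  defines "w2 \<equiv> complex_of_real (\<omega>$1)" and "w3 \<equiv> complex_of_real (\<omega>$2)"
  shows "(M_mat \<omega> *v v) $ 1 = (w2^2 - w3^2) * v$1 + 2 * w2 * w3 * v$2"
    "(M_mat \<omega> *v v) $ 2 = 2 * w2 * w3 * v$1 - (w2^2 - w3^2) * v$2"
  by (simp_all add: M_mat_def Let_def w2_def w3_def algebra_simps)

lemma norm_sq_real2: "(norm (\<omega> :: real^2))^2 = (\<omega>$1)^2 + (\<omega>$2)^2"
  by (simp only: power2_norm_eq_inner) (simp add: inner_vec_def sum_2 power2_eq_square)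

lemma M_mat_square: "M_mat \<omega> *v (M_mat \<omega> *v v) = complex_of_real ((norm \<omega>)^4) *s v"
proof -
  have "(norm \<omega>)^4 = ((\<omega>$1)^2 + (\<omega>$2)^2)^2"
    by (simp flip: norm_sq_real2)
  then show ?thesis
    by (simp add: vec_eq_iff forall_2) (simp add: algebra_simps power2_eq_square)
qed

text \<open>
  Elimination of \<open>x\<^sub>s\<close>: its value is read off the middle rows and inserted into the outer ones.
  The factor \<open>s\<close> on the left clears the denominator that solving for \<open>x\<^sub>s\<close> introduces.
\<close>

lemma N_mat_schur_complement:
  fixes \<omega> s x
  defines "h \<equiv> s^2 + complex_of_real ((norm \<omega>)^2) / 2"
  assumes "s_part (N_mat \<omega> s *v x) = 0"
  shows "s *s plus_part (N_mat \<omega> s *v x) = h *s plus_part x - (1/2) *s (M_mat \<omega> *v minus_part x)"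
    and "s *s minus_part (N_mat \<omega> s *v x) = h *s minus_part x - (1/2) *s (M_mat \<omega> *v plus_part x)"
proof -
  define w2 w3 t where w: "w2 = complex_of_real (\<omega>$1)" "w3 = complex_of_real (\<omega>$2)"
    "t = \<i> * complex_of_real (sqrt 2 / 2)"
  note N = N_mat_mult_nth[of \<omega> s x, folded w(1,2), folded w(3)]
  have t: "t * t = - (1/2)"
  proof -
    have "t * t = (\<i> * \<i>) * complex_of_real ((sqrt 2 / 2) * (sqrt 2 / 2))"
      unfolding w of_real_mult by (simp only: ac_simps)
    then show ?thesis by simp
  qed
  have "(N_mat \<omega> s *v x) $ 3 = 0" "(N_mat \<omega> s *v x) $ 4 = 0"
    using assms(2) by (metis part_nth(3,4) zero_index)+
  then have e: "s * x$3 = t * (w2 * x$2 - w3 * x$1 + w2 * x$6 - w3 * x$5)"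
    "s * x$4 = t * (w2 * x$1 + w3 * x$2 - w2 * x$5 - w3 * x$6)"
    by (simp_all add: N)
  have h: "2 * h = 2 * s^2 + (w2^2 + w3^2)"
    by (simp add: h_def norm_sq_real2 w)
  have
    "2 * (s * (s * x$1 + t * (w3 * x$3 - w2 * x$4)))
      = 2 * h * x$1 - ((w2^2 - w3^2) * x$5 + 2 * w2 * w3 * x$6)"
    "2 * (s * (s * x$2 - t * (w2 * x$3 + w3 * x$4)))
      = 2 * h * x$2 - (2 * w2 * w3 * x$5 - (w2^2 - w3^2) * x$6)"
    "2 * (s * (s * x$5 + t * (w3 * x$3 + w2 * x$4)))
      = 2 * h * x$5 - ((w2^2 - w3^2) * x$1 + 2 * w2 * w3 * x$2)"
    "2 * (s * (s * x$6 + t * (w3 * x$4 - w2 * x$3)))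
      = 2 * h * x$6 - (2 * w2 * w3 * x$1 - (w2^2 - w3^2) * x$2)"
    using e t unfolding h by algebra+
  then show "s *s plus_part (N_mat \<omega> s *v x) = h *s plus_part x - (1/2) *s (M_mat \<omega> *v minus_part x)"
    and "s *s minus_part (N_mat \<omega> s *v x) = h *s minus_part x - (1/2) *s (M_mat \<omega> *v plus_part x)"
    by (simp_all add: vec_eq_iff forall_2 N field_simps flip: w)
qed

section \<open>Eigenfunctionals of the layer operators\<close>

text \<open>
  The left eigenvectors that are biorthogonal to the columns of \<open>\<Psi>\<^sub>L\<close> and \<open>\<Psi>\<^sub>R\<close>: on combinations of
  these columns, each of the two functionals extracts one of the two coefficient vectors up to a
  common scalar.
\<close>

definition coef_L :: "real^2 \<Rightarrow> complex \<Rightarrow> complex^6 \<Rightarrow> complex^2" where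
  "coef_L \<omega> s x = (kap \<omega> s + s)^2 *s minus_part x - M_mat \<omega> *v plus_part x"

definition coef_R :: "real^2 \<Rightarrow> complex \<Rightarrow> complex^6 \<Rightarrow> complex^2" where
  "coef_R \<omega> s x = (kap \<omega> s + s)^2 *s plus_part x - M_mat \<omega> *v minus_part x"

lemma kap_square: "(kap \<omega> s)^2 = s^2 + complex_of_real ((norm \<omega>)^2)"
  by (simp add: kap_def)

text \<open>
  With \<open>p = x\<^sub>+\<close>, \<open>q = x\<^sub>-\<close> and \<open>h = s\<^sup>2 + |\<omega>|\<^sup>2 / 2\<close>, the Schur complement turns \<open>s \<Phi>(\<Lambda> N x)\<close> into
  \<open>- (\<sigma>\<^sup>2 h - |\<omega>|\<^sup>4 / 2) q - (h - \<sigma>\<^sup>2 / 2) M p\<close>. The eigenvalue appears because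
  \<open>\<sigma>\<^sup>2 = 2 (h + \<kappa> s)\<close> and \<open>|\<omega>|\<^sup>2 = \<sigma> (\<kappa> - s)\<close>; the other functional is the mirror image.
\<close>

lemma coef_Lam_N_mat:
  assumes "s \<noteq> 0" and "s_part (N_mat \<omega> s *v x) = 0"
  shows "coef_L \<omega> s (Lam *v (N_mat \<omega> s *v x)) = (- kap \<omega> s) *s coef_L \<omega> s x"
    and "coef_R \<omega> s (Lam *v (N_mat \<omega> s *v x)) = kap \<omega> s *s coef_R \<omega> s x"
proof -
  define y k \<sigma> h where "y = N_mat \<omega> s *v x" and "k = kap \<omega> s" and "\<sigma> = kap \<omega> s + s"
    and "h = s^2 + complex_of_real ((norm \<omega>)^2) / 2"
  define p q where "p = plus_part x" and "q = minus_part x"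
  let ?M = "\<lambda>v. M_mat \<omega> *v v" and ?W = "complex_of_real ((norm \<omega>)^2)"
  note schur = N_mat_schur_complement[OF assms(2), folded y_def h_def p_def q_def]
  have [simp]: "plus_part (Lam *v y) = plus_part y" "minus_part (Lam *v y) = - minus_part y"
    by (simp_all add: vec_eq_iff forall_2)
  have MM: "?M (?M v) = (?W^2) *s v" for v
    by (simp add: M_mat_square)
  have neg: "?M (- v) = - ?M v" for v
    by (simp add: vec_eq_iff forall_2)
  have scal: "2 * h = 2 * s^2 + ?W" "k^2 = s^2 + ?W" "\<sigma> = k + s"
    by (simp_all add: h_def k_def \<sigma>_def kap_square)

  have "s *s coef_L \<omega> s (Lam *v y) = - (\<sigma>^2 *s (s *s minus_part y)) - ?M (s *s plus_part y)"
    by (simp add: coef_L_def \<sigma>_def vec_eq_iff vector_scalar_commute algebra_simps)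
  also have "\<dots> = - (\<sigma>^2 *s (h *s q - (1/2) *s ?M p)) - (h *s ?M p - (1/2) *s (?W^2 *s q))"
    unfolding schur by (simp only: matrix_vector_mult_diff_distrib vector_scalar_commute MM)
  also have "\<dots> = s *s ((- k) *s (\<sigma>^2 *s q - ?M p))"
  proof -
    \<comment> \<open>The factor 2 is there because \<open>scal\<close> determines \<open>2 h\<close>, without a division.\<close>
    have "2 * (- (\<sigma>^2 * (h * b - (1/2) * c)) - (h * c - (1/2) * (?W^2 * b)))
        = 2 * (s * (- k * (\<sigma>^2 * b - c)))" for b c
      using scal by algebra
    then show ?thesis
      by (simp only: vec_eq_iff vector_minus_component vector_uminus_component vector_add_component
          vector_smult_component mult_cancel_left) simp
  qed
  finally show "coef_L \<omega> s (Lam *v y) = (- kap \<omega> s) *s coef_L \<omega> s x"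
    using assms(1) unfolding coef_L_def p_def q_def \<sigma>_def k_def
    by (simp only: vector_mul_lcancel) simp

  have "s *s coef_R \<omega> s (Lam *v y) = \<sigma>^2 *s (s *s plus_part y) + ?M (s *s minus_part y)"
    by (simp add: coef_R_def \<sigma>_def neg vec_eq_iff vector_scalar_commute algebra_simps)
  also have "\<dots> = \<sigma>^2 *s (h *s p - (1/2) *s ?M q) + (h *s ?M q - (1/2) *s (?W^2 *s p))"
    unfolding schur by (simp only: matrix_vector_mult_diff_distrib vector_scalar_commute MM)
  also have "\<dots> = s *s (k *s (\<sigma>^2 *s p - ?M q))"
  proof -
    have "2 * (\<sigma>^2 * (h * b - (1/2) * c) + (h * c - (1/2) * (?W^2 * b)))
        = 2 * (s * (k * (\<sigma>^2 * b - c)))" for b c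
      using scal by algebra
    then show ?thesis
      by (simp only: vec_eq_iff vector_minus_component vector_uminus_component vector_add_component
          vector_smult_component mult_cancel_left) simp
  qed
  finally show "coef_R \<omega> s (Lam *v y) = kap \<omega> s *s coef_R \<omega> s x"
    using assms(1) unfolding coef_R_def p_def q_def \<sigma>_def k_def
    by (simp only: vector_mul_lcancel) simp
qed

lemma coef_Lam_L_mat:
  assumes "s \<noteq> 0" and "s_part (N_mat \<omega> s *v x) = 0"
  shows "coef_L \<omega> s (Lam *v (L_mat a \<omega> s *v x)) = gam_plus a \<omega> s *s coef_L \<omega> s x"
    and "coef_R \<omega> s (Lam *v (L_mat a \<omega> s *v x)) = gam_minus a \<omega> s *s coef_R \<omega> s x"
proof -
  have "coef_L \<omega> s (Lam *v (L_mat a \<omega> s *v x))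
      = (complex_of_real a * s) *s coef_L \<omega> s x - coef_L \<omega> s (Lam *v (N_mat \<omega> s *v x))"
    "coef_R \<omega> s (Lam *v (L_mat a \<omega> s *v x))
      = (complex_of_real a * s) *s coef_R \<omega> s x - coef_R \<omega> s (Lam *v (N_mat \<omega> s *v x))"
    by (simp_all add: coef_L_def coef_R_def vec_eq_iff forall_2 L_mat_mult_nth algebra_simps)
  then show "coef_L \<omega> s (Lam *v (L_mat a \<omega> s *v x)) = gam_plus a \<omega> s *s coef_L \<omega> s x"
    and "coef_R \<omega> s (Lam *v (L_mat a \<omega> s *v x)) = gam_minus a \<omega> s *s coef_R \<omega> s x"
    by (simp_all add: coef_Lam_N_mat[OF assms] gam_plus_def gam_minus_def vec_eq_iff algebra_simps)
qed

lemma coef_Lam_K_mat: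
  assumes "s \<noteq> 0" and "s_part (N_mat \<omega> s *v x) = 0"
  shows "coef_L \<omega> s (Lam *v (K_mat a \<omega> s *v x)) = gam_minus a \<omega> s *s coef_L \<omega> s x"
    and "coef_R \<omega> s (Lam *v (K_mat a \<omega> s *v x)) = gam_plus a \<omega> s *s coef_R \<omega> s x"
proof -
  have "coef_L \<omega> s (Lam *v (K_mat a \<omega> s *v x))
      = (complex_of_real a * s) *s coef_L \<omega> s x + coef_L \<omega> s (Lam *v (N_mat \<omega> s *v x))"
    "coef_R \<omega> s (Lam *v (K_mat a \<omega> s *v x))
      = (complex_of_real a * s) *s coef_R \<omega> s x + coef_R \<omega> s (Lam *v (N_mat \<omega> s *v x))"
    by (simp_all add: coef_L_def coef_R_def vec_eq_iff forall_2 K_mat_mult_nth algebra_simps)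
  then show "coef_L \<omega> s (Lam *v (K_mat a \<omega> s *v x)) = gam_minus a \<omega> s *s coef_L \<omega> s x"
    and "coef_R \<omega> s (Lam *v (K_mat a \<omega> s *v x)) = gam_plus a \<omega> s *s coef_R \<omega> s x"
    by (simp_all add: coef_Lam_N_mat[OF assms] gam_plus_def gam_minus_def vec_eq_iff algebra_simps)
qed

text \<open>
  The cross terms cancel, and the two contributions to the remaining factor are \<open>\<sigma>\<^sup>4\<close> and, by
  \<open>M\<^sup>2 = |\<omega>|\<^sup>4\<close>, \<open>- |\<omega>|\<^sup>4\<close>.
\<close>

lemma coef_Psi:
  fixes \<omega> s
  defines "n \<equiv> ((kap \<omega> s + s)^4 - complex_of_real ((norm \<omega>)^4)) / complex_of_real (c_Psi \<omega> s)"
  assumes "x = Psi_L \<omega> s *v c + Psi_R \<omega> s *v d"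
  shows "coef_L \<omega> s x = n *s c" and "coef_R \<omega> s x = n *s d"
proof -
  define b where "b = 1 / complex_of_real (c_Psi \<omega> s)"
  define S where "S = (kap \<omega> s + s)^2"
  have S: "(kap \<omega> s + s)^4 = S * S"
    by (simp add: S_def flip: power_add)
  have p: "plus_part x = b *s (M_mat \<omega> *v c + S *s d)"
    and m: "minus_part x = b *s (S *s c + M_mat \<omega> *v d)"
    by (simp_all add: assms(2) vec_eq_iff forall_2 Psi_L_def Psi_R_def b_def S_def)
       (simp_all add: matrix_vector_mult_def sum_2 mat_def M_mat_def mat2_def Let_def algebra_simps)
  have n: "n = b * (S * S - complex_of_real ((norm \<omega>)^4))"
    by (simp add: n_def S b_def)
  show "coef_L \<omega> s x = n *s c" and "coef_R \<omega> s x = n *s d"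
    unfolding coef_L_def coef_R_def p m n S_def[symmetric]
    by (simp_all add: vector_scalar_commute[symmetric] matrix_vector_right_distrib M_mat_square)
       (simp_all add: vec_eq_iff algebra_simps)
qed

section \<open>The scalars that are divided by\<close>

text \<open>
  The principal root has zero real part only if \<open>s\<^sup>2 + |\<omega>|\<^sup>2\<close> is a nonpositive real. For
  \<open>Re s > 0\<close> a real value of \<open>s\<^sup>2\<close> forces \<open>s\<close> to be real, and then the sum is positive.
\<close>

lemma Re_kap_pos:
  assumes "Re s > 0"
  shows "Re (kap \<omega> s) > 0"
proof -
  have "Re (kap \<omega> s) \<noteq> 0"
  proof
    assume *: "Re (kap \<omega> s) = 0"
    from kap_square[of \<omega> s] have "Re ((kap \<omega> s)^2) = Re (s^2 + complex_of_real ((norm \<omega>)^2))"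
      and "Im ((kap \<omega> s)^2) = Im (s^2 + complex_of_real ((norm \<omega>)^2))" by simp_all
    with * assms have "Im s = 0" and "- ((Im (kap \<omega> s))^2) = (Re s)^2 - (Im s)^2 + (norm \<omega>)^2"
      by (simp_all add: power2_eq_square)
    moreover have "(Re s)^2 > 0" using assms by simp
    ultimately show False
      using zero_le_power2[of "Im (kap \<omega> s)"] zero_le_power2[of "norm \<omega>"] by simp
  qed
  moreover have "Re (kap \<omega> s) \<ge> 0"
    unfolding kap_def using csqrt_principal by (metis less_eq_real_def)
  ultimately show ?thesis by simp
qed

lemma gam_plus_nonzero:
  assumes "Re s > 0" and "a > 0"
  shows "gam_plus a \<omega> s \<noteq> 0"
proof -
  have "Re (gam_plus a \<omega> s) > 0"
    using Re_kap_pos[OF assms(1), of \<omega>] assms by (simp add: gam_plus_def add_pos_pos)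
  then show ?thesis by auto
qed

text \<open>
  The scalar that measures the independence of the columns of \<open>\<Psi>\<^sub>L\<close> from those of \<open>\<Psi>\<^sub>R\<close>, factored
  by means of \<open>|\<omega>|\<^sup>2 = (\<kappa> + s) (\<kappa> - s)\<close>.
\<close>

lemma Psi_determinant:
  "(kap \<omega> s + s)^4 - complex_of_real ((norm \<omega>)^4) = 4 * kap \<omega> s * s * (kap \<omega> s + s)^2"
proof -
  have "complex_of_real ((norm \<omega>)^4) = ((kap \<omega> s)^2 - s^2)^2"
    by (simp add: kap_square)
  then show ?thesis by algebra
qed

section \<open>The reflection coefficient\<close>

theorem lemma3p16:
  fixes J :: nat and a :: "nat \<Rightarrow> real" and \<omega> :: "real^2" and s :: complex
    and \<rho> :: "nat \<Rightarrow> complex^6" and c0 d0 :: "complex^2"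
  assumes "J \<ge> 1"
    and "(\<omega>, s) \<in> U_set"
    and "0 < a 0" and "a 0 \<le> 1"
    and "\<And>j. 1 \<le> j \<Longrightarrow> j \<le> J \<Longrightarrow> 0 < a j \<and> a j < 1"
    and "(s *m Lam) *v \<rho> 1 - L_mat (a 0) \<omega> s *v \<rho> 0 = 0"
    and "\<And>j. 1 \<le> j \<Longrightarrow> j \<le> J \<Longrightarrow>
           L_mat (a j) \<omega> s *v \<rho> j - K_mat (a j) \<omega> s *v \<rho> (j + 1) = 0"
    and "minus_part (\<rho> (J + 1)) = 0"
    and "s_part (\<rho> 1) =
           (1 / s) *s (((\<i> * complex_of_real (\<omega>$1)) *m E_T
                        - (\<i> * complex_of_real (\<omega>$2)) *m J_T) *v plus_part (\<rho> 1))
         + (1 / s) *s (((\<i> * complex_of_real (\<omega>$1)) *m D_T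
                        - (\<i> * complex_of_real (\<omega>$2)) *m I_T) *v minus_part (\<rho> 1))"
    and "\<rho> 0 = Psi_L \<omega> s *v c0 + Psi_R \<omega> s *v d0"
  shows "c0 = R_mat J a \<omega> s *v d0"
proof -
  define \<sigma> where "\<sigma> = kap \<omega> s + s"
  define r where "r j = gam_minus (a j) \<omega> s / gam_plus (a j) \<omega> s" for j
  define \<Phi> where "\<Phi> j = coef_L \<omega> s (\<rho> j)" for j
  define \<Theta> where "\<Theta> j = coef_R \<omega> s (\<rho> j)" for j
  have s: "Re s > 0" "s \<noteq> 0"
    using assms(2) by (auto simp: U_set_def)
  have kap: "kap \<omega> s \<noteq> 0" and \<sigma>: "\<sigma> \<noteq> 0"
    using s(1) Re_kap_pos[OF s(1), of \<omega>] by (auto simp: \<sigma>_def complex_eq_iff)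
  have gp: "gam_plus (a j) \<omega> s \<noteq> 0" if "j \<le> J" for j
    using that assms(3) assms(5)[of j] gam_plus_nonzero[OF s(1), of "a j" \<omega>] by (cases j) auto

  have first: "(s *m Lam) *v \<rho> 1 = L_mat (a 0) \<omega> s *v \<rho> 0"
    using assms(6) by simp
  have rec: "L_mat (a j) \<omega> s *v \<rho> j = K_mat (a j) \<omega> s *v \<rho> (Suc j)" if "1 \<le> j" "j \<le> J" for j
    using assms(7)[OF that] by simp

  \<comment> \<open>The middle rows of \<open>\<Lambda>\<close> vanish, so the layer equations carry this constraint along.\<close>
  have N0: "s_part (N_mat \<omega> s *v \<rho> 0) = 0"
    using arg_cong[OF first, of s_part] by (simp add: vec_eq_iff forall_2 L_mat_mult_nth)
  have N: "s_part (N_mat \<omega> s *v \<rho> j) = 0" if "1 \<le> j" "j \<le> Suc J" for j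
    using that
  proof (induction j rule: nat_induct_at_least)
    case base
    show ?case
      using assms(9) s_part_N_mat_zero_iff[OF s(2)] by blast
  next
    case (Suc j)
    then have "s_part (L_mat (a j) \<omega> s *v \<rho> j) = s_part (K_mat (a j) \<omega> s *v \<rho> (Suc j))"
      using rec[of j] by simp
    moreover have "s_part (N_mat \<omega> s *v \<rho> j) = 0"
      using Suc by simp
    ultimately show ?case
      by (simp add: vec_eq_iff forall_2 L_mat_mult_nth K_mat_mult_nth)
  qed

  have "s *s \<Phi> 1 = gam_plus (a 0) \<omega> s *s \<Phi> 0" and "s *s \<Theta> 1 = gam_minus (a 0) \<omega> s *s \<Theta> 0"
    unfolding \<Phi>_def \<Theta>_def coef_Lam_L_mat[OF s(2) N0, symmetric] first[symmetric]
    by (simp_all add: coef_L_def coef_R_def vec_eq_iff forall_2 algebra_simps)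
  then have start: "\<Phi> 0 = (s / gam_plus (a 0) \<omega> s) *s \<Phi> 1" "\<Theta> 1 = (gam_minus (a 0) \<omega> s / s) *s \<Theta> 0"
    using gp[of 0] s(2) by (simp_all add: vec_eq_iff field_simps)

  have step: "\<Phi> j = r j *s \<Phi> (Suc j)" "\<Theta> (Suc j) = r j *s \<Theta> j" if "1 \<le> j" "j \<le> J" for j
  proof -
    have "gam_plus (a j) \<omega> s *s \<Phi> j = gam_minus (a j) \<omega> s *s \<Phi> (Suc j)"
      and "gam_minus (a j) \<omega> s *s \<Theta> j = gam_plus (a j) \<omega> s *s \<Theta> (Suc j)"
      using coef_Lam_L_mat[OF s(2) N[of j], of "a j"] coef_Lam_K_mat[OF s(2) N[of "Suc j"], of "a j"]
        rec[OF that] that by (simp_all add: \<Phi>_def \<Theta>_def)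
    then show "\<Phi> j = r j *s \<Phi> (Suc j)" "\<Theta> (Suc j) = r j *s \<Theta> j"
      using gp[OF that(2)] by (simp_all add: vec_eq_iff r_def field_simps)
  qed
  have iter: "\<Phi> 1 = (\<Prod>i=1..j. r i) *s \<Phi> (Suc j) \<and> \<Theta> (Suc j) = (\<Prod>i=1..j. r i) *s \<Theta> 1" if "j \<le> J" for j
    using that
  proof (induction j)
    case (Suc j)
    then show ?case
      using step[of "Suc j"] by (simp add: mult.commute)
  qed simp

  \<comment> \<open>The end condition removes one of the two terms from each functional.\<close>
  have "\<sigma>^2 *s \<Phi> (Suc J) = - (M_mat \<omega> *v \<Theta> (Suc J))"
    using assms(8)
    by (simp add: \<Phi>_def \<Theta>_def coef_L_def coef_R_def \<sigma>_def vector_scalar_commute)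
  then have final: "\<Phi> (Suc J) = (- (1 / \<sigma>^2)) *s (M_mat \<omega> *v \<Theta> (Suc J))"
    using \<sigma> by (simp add: vec_eq_iff field_simps)

  have "\<Phi> 0 = (- (gam J a \<omega> s / \<sigma>^2)) *s (M_mat \<omega> *v \<Theta> 0)"
  proof -
    let ?P = "\<Prod>i=1..J. r i"
    have P: "\<Phi> 1 = ?P *s \<Phi> (Suc J)" "\<Theta> (Suc J) = ?P *s \<Theta> 1"
      using iter[of J] by blast+
    have "\<Phi> 0 = (s / gam_plus (a 0) \<omega> s) *s (?P *s ((- (1 / \<sigma>^2)) *s
        (M_mat \<omega> *v (?P *s ((gam_minus (a 0) \<omega> s / s) *s \<Theta> 0)))))"
      by (subst start(1), subst P(1), subst final, subst P(2), subst start(2)) (rule refl)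
    also have "\<dots> = ((s / gam_plus (a 0) \<omega> s) * ?P * (- (1 / \<sigma>^2)) * ?P * (gam_minus (a 0) \<omega> s / s))
        *s (M_mat \<omega> *v \<Theta> 0)"
      by (simp add: vector_scalar_commute[symmetric] mult.assoc)
    also have "(s / gam_plus (a 0) \<omega> s) * ?P * (- (1 / \<sigma>^2)) * ?P * (gam_minus (a 0) \<omega> s / s)
        = - (gam J a \<omega> s / \<sigma>^2)"
    proof -
      have "gam J a \<omega> s = gam_minus (a 0) \<omega> s / gam_plus (a 0) \<omega> s * (?P * ?P)"
        unfolding gam_def r_def[symmetric] by (simp only: power2_eq_square prod.distrib)
      then show ?thesis
        using s(2) gp[of 0] \<sigma> by (simp add: field_simps)
    qed
    finally show ?thesis .
  qed
  then have eq: "\<Phi> 0 = R_mat J a \<omega> s *v \<Theta> 0"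
    by (simp add: R_mat_def \<sigma>_def vec_eq_iff)

  obtain n where n: "n \<noteq> 0" "\<Phi> 0 = n *s c0" "\<Theta> 0 = n *s d0"
  proof
    have "(cmod \<sigma>)^4 + (norm \<omega>)^4 > 0"
      using \<sigma> by (simp add: add_pos_nonneg)
    then have "c_Psi \<omega> s \<noteq> 0"
      by (simp add: c_Psi_def \<sigma>_def)
    then show "((kap \<omega> s + s)^4 - complex_of_real ((norm \<omega>)^4)) / complex_of_real (c_Psi \<omega> s) \<noteq> 0"
      using s(2) kap \<sigma> unfolding Psi_determinant \<sigma>_def by simp
  qed (simp_all only: \<Phi>_def \<Theta>_def coef_Psi[OF assms(10)])
  have "n *s c0 = n *s (R_mat J a \<omega> s *v d0)"
    using eq n by (simp add: vector_scalar_commute)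
  then show ?thesis
    using n(1) by (simp add: vector_mul_lcancel)
qed

end
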